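(* Let $k>2$, and let $\mathcal D$ be a distribution over $\mathbb R^d$ with mean $0$ and $\sigma_k(\mathcal D)\le1$. Let $X_1,\dots,X_m\sim\mathcal D$ i.i.d. and $X=\frac1m\sum_{i=1}^mX_i$. There exists $t_3=O\big(\sqrt d\log^{1/k}m\big)$ such that for all $t\ge t_3$, \[ \Pr[\|X\|_2\ge t]=\tilde O\left(\frac{d^{k/2}}{m^{k-1}t^k}\right). \]
   Context: $\sigma_k(\mathcal D)=\sup_{\|v\|_2=1}\mathbb E_{Y\sim\mathcal D}[|\langle Y-\mathbb E Y,v\rangle|^k]^{1/k}$. $\tilde O$ hides factors depending only on $k$ and polylogarithmic factors in $m$. *)

theory Defs
  imports "HOL-Probability.Probability"
begin

text \<open>
  Points of \<open>R^d\<close> are functions on the index set \<open>{..<d}\<close>, and the Borel space of \<open>R^d\<close> is the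
  product space below. The dimension is a natural number rather than a type so that bounds can be
  stated with constants that are uniform in \<open>d\<close>. The Euclidean norm of \<open>x\<close> is
  \<open>L2_set x {..<d}\<close>.
\<close>

definition Rd :: "nat \<Rightarrow> (nat \<Rightarrow> real) measure" where
  "Rd d = (\<Pi>\<^sub>M i\<in>{..<d}. borel)"

definition distribution_on_Rd :: "nat \<Rightarrow> (nat \<Rightarrow> real) measure \<Rightarrow> bool" where
  "distribution_on_Rd d D \<longleftrightarrow> prob_space D \<and> sets D = sets (Rd d)"

definition inner_Rd :: "nat \<Rightarrow> (nat \<Rightarrow> real) \<Rightarrow> (nat \<Rightarrow> real) \<Rightarrow> real" where
  "inner_Rd d x y = (\<Sum>i<d. x i * y i)"

definition mean_Rd :: "(nat \<Rightarrow> real) measure \<Rightarrow> nat \<Rightarrow> real" where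
  "mean_Rd D = (\<lambda>i. \<integral>y. y i \<partial>D)"

text \<open>
  The integral of a non-integrable coordinate is \<open>0\<close> by convention, so integrability is required
  explicitly.
\<close>

definition has_mean_zero :: "nat \<Rightarrow> (nat \<Rightarrow> real) measure \<Rightarrow> bool" where
  "has_mean_zero d D \<longleftrightarrow> (\<forall>i<d. integrable D (\<lambda>y. y i) \<and> mean_Rd D i = 0)"

text \<open>Real powers on \<open>[0, \<infinity>]\<close>, meant for \<open>p > 0\<close>.\<close>

definition ennpowr :: "ennreal \<Rightarrow> real \<Rightarrow> ennreal" where
  "ennpowr x p = (if x = \<infinity> then \<infinity> else ennreal (enn2real x powr p))"

text \<open>
  The supremum is taken in \<open>[0, \<infinity>]\<close>, so that a finite bound on \<open>sigma_k\<close> entails that the directional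
  moments of order \<open>k\<close> are finite.
\<close>

definition sigma_k :: "real \<Rightarrow> nat \<Rightarrow> (nat \<Rightarrow> real) measure \<Rightarrow> ennreal" where
  "sigma_k k d D =
    (SUP v \<in> {v. L2_set v {..<d} = 1}.
      ennpowr (\<integral>\<^sup>+ y. ennreal (\<bar>inner_Rd d (\<lambda>i. y i - mean_Rd D i) v\<bar> powr k) \<partial>D) (1 / k))"

text \<open>The joint law of \<open>m\<close> independent samples from \<open>D\<close>.\<close>

definition iid_samples :: "nat \<Rightarrow> (nat \<Rightarrow> real) measure \<Rightarrow> (nat \<Rightarrow> nat \<Rightarrow> real) measure" where
  "iid_samples m D = (\<Pi>\<^sub>M i\<in>{..<m}. D)"

definition sample_mean :: "nat \<Rightarrow> (nat \<Rightarrow> nat \<Rightarrow> real) \<Rightarrow> nat \<Rightarrow> real" where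
  "sample_mean m X = (\<lambda>j. (1 / real m) * (\<Sum>i<m. X i j))"

end

(* Truncate the samples at norm s = m t / 2. A union bound and Markov's inequality for the moment of
order k, E |Y|^k <= d^(k/2), control the event that some sample is truncated. For the truncated sum
S_n, the convexity of v |-> cosh (sqrt v) gives Pinelis' one-step inequality
E cosh (l |x + Z|) <= cosh (l |x|) (1 + E (exp (l |Z|) - 1 - l |Z|)) up to the small bias of the
truncation, hence E cosh (l |S_m|) is bounded by a product. With delta = d^(k/2) / (m^(k-1) t^k)
and l = ln (1 / delta) / (m t) this product is bounded by a constant depending only on k as soon as
t >= sqrt d, and Markov's inequality costs the factor 1 / cosh (ln (1 / delta)) <= 2 delta.
No logarithmic factor is lost. *)
theory Submission
  imports Defs
begin

section \<open>Scalar inequalities for cosh, exp and real powers\<close>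

lemma le_sinh:
  fixes x :: real
  assumes "0 \<le> x"
  shows "x \<le> sinh x"
proof -
  have "sinh 0 - 0 \<le> sinh x - x"
  proof (rule DERIV_nonneg_imp_nondecreasing[OF assms])
    fix y :: real
    show "\<exists>D. ((\<lambda>x. sinh x - x) has_real_derivative D) (at y) \<and> 0 \<le> D"
      by (rule exI[of _ "cosh y - 1"]) (auto intro!: derivative_eq_intros simp: cosh_real_ge_1)
  qed
  then show ?thesis by simp
qed

text \<open>The power series in \<open>v\<close> has terms \<open>v ^ n / fact (2 * n)\<close>:
  nonnegative coefficients times monomials that are convex on the half-line. Convexity passes to the
  sum term by term.\<close>

lemma convex_on_cosh_sqrt: "convex_on {0..} (\<lambda>v::real. cosh (sqrt v))"
proof (rule convex_onI)
  define h where "h v n = (if even n then v ^ (n div 2) / fact n else 0)" for v :: real and n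
  have h: "h v sums cosh (sqrt v)" if "0 \<le> v" for v
  proof -
    have "(\<lambda>n. if even n then sqrt v ^ n /\<^sub>R fact n else 0) = h v"
      using that by (auto simp: h_def fun_eq_iff power_mult divide_inverse elim!: evenE)
    then show ?thesis using cosh_converges[of "sqrt v"] by simp
  qed
  fix t x y :: real
  assume t: "0 < t" "t < 1" and x: "x \<in> {0..}" and y: "y \<in> {0..}"
  have conv: "convex_on {0::real..} (\<lambda>x. x ^ n)" for n
    by (cases "even n") (auto intro: convex_power_odd convex_on_subset[OF convex_power_even])
  have le: "h ((1 - t) *\<^sub>R x + t *\<^sub>R y) n \<le> (1 - t) * h x n + t * h y n" for n
    using convex_onD[OF conv[of "n div 2"], of t x y] t x y
    by (auto simp: h_def divide_simps)
  have "0 \<le> (1 - t) *\<^sub>R x + t *\<^sub>R y"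
    using t x y by auto
  then show "cosh (sqrt ((1 - t) *\<^sub>R x + t *\<^sub>R y)) \<le> (1 - t) * cosh (sqrt x) + t * cosh (sqrt y)"
    using x y le by (intro sums_le[OF _ h sums_add[OF sums_mult[OF h] sums_mult[OF h]]]) auto
qed auto

text \<open>In the application \<open>a\<close>, \<open>b\<close>, \<open>c\<close> are the scaled
  norms of two vectors and of their sum, and \<open>w\<close> is the scaled inner product. Since
  \<open>c\<^sup>2\<close> is affine in \<open>w\<close>, convexity puts \<open>cosh c\<close> below
  its chord between \<open>w = - a * b\<close> and \<open>w = a * b\<close>. The coefficient of
  \<open>w\<close> is kept free of \<open>b\<close>, so that a centered second vector makes this
  term vanish in expectation.\<close>

lemma cosh_chord:
  fixes a b c w :: real
  assumes "0 \<le> a" "0 \<le> b" "0 \<le> c" and w: "\<bar>w\<bar> \<le> a * b" and c: "c\<^sup>2 = a\<^sup>2 + b\<^sup>2 + 2 * w"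
  shows "cosh c \<le> cosh a * (exp b - b) + sinh a / a * w"
proof -
  have eb: "exp b = cosh b + sinh b" by (simp add: cosh_plus_sinh)
  have sb: "b \<le> sinh b" using le_sinh assms by simp
  consider "a = 0" | "b = 0" | "a > 0" "b > 0" using assms by linarith
  then show ?thesis
  proof cases
    case 1
    \<comment> \<open>Here \<open>sinh a / a\<close> is \<open>0\<close> by the convention for
      division by zero; this is harmless because \<open>w = 0\<close> as well.\<close>
    then have "c = b" using w c assms by simp
    then show ?thesis using 1 sb by (simp add: eb)
  next
    case 2
    then have "c = a" using w c assms by simp
    then show ?thesis using 2 w by simp
  next
    case 3
    \<comment> \<open>The weight that writes \<open>c\<^sup>2\<close> as a convex combination of
      \<open>(a - b)\<^sup>2\<close> and \<open>(a + b)\<^sup>2\<close>.\<close>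
    define t where "t = (1 + w / (a * b)) / 2"
    have ab: "a * b > 0" using 3 by simp
    have wab: "w / (a * b) \<le> 1" "-1 \<le> w / (a * b)"
      using w ab by (auto simp: divide_simps abs_le_iff)
    have t: "0 \<le> t" "t \<le> 1" using wab by (auto simp: t_def)
    have "(1 - t) * (a - b)\<^sup>2 + t * (a + b)\<^sup>2 = a\<^sup>2 + b\<^sup>2 + 2 * w"
      using 3 by (simp add: t_def power2_eq_square field_simps)
    then have c2: "(1 - t) * (a - b)\<^sup>2 + t * (a + b)\<^sup>2 = c\<^sup>2"
      by (simp add: c)
    have "cosh (sqrt (c\<^sup>2)) \<le> (1 - t) * cosh (sqrt ((a - b)\<^sup>2)) + t * cosh (sqrt ((a + b)\<^sup>2))"
      using convex_onD[OF convex_on_cosh_sqrt, of t "(a - b)\<^sup>2" "(a + b)\<^sup>2"] t by (simp add: c2)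
    then have "cosh c \<le> (1 - t) * cosh (a - b) + t * cosh (a + b)"
      using 3 \<open>0 \<le> c\<close> by simp
    also have "\<dots> = cosh a * cosh b + w / (a * b) * (sinh a * sinh b)"
      by (simp add: t_def cosh_add cosh_diff field_simps)
    \<comment> \<open>Splitting \<open>sinh b\<close> into \<open>b\<close> and
      \<open>sinh b - b\<close> isolates the wanted linear term. The remainder is at most
      \<open>cosh a * (sinh b - b)\<close>, because \<open>w / (a * b)\<close> is at most
      \<open>1\<close> and \<open>sinh a\<close> at most \<open>cosh a\<close>.\<close>
    also have "\<dots> = cosh a * cosh b + sinh a / a * w + w / (a * b) * (sinh a * (sinh b - b))"
      using 3 by (simp add: field_simps)
    also have "\<dots> \<le> cosh a * cosh b + sinh a / a * w + 1 * (cosh a * (sinh b - b))"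
      using wab sb 3 sinh_le_cosh_real[of a]
      by (intro add_left_mono order_trans[OF mult_right_mono mult_left_mono[OF mult_right_mono]]) auto
    finally show ?thesis by (simp add: eb algebra_simps)
  qed
qed

text \<open>Up to \<open>1\<close> the quadratic Taylor bound suffices; beyond \<open>1\<close> the
  factor \<open>x powr k\<close> is at least \<open>1\<close>, so the last summand alone dominates
  \<open>exp x\<close>. Thus moments of order \<open>2\<close> and \<open>k\<close> control an
  exponential of a bounded variable.\<close>

lemma exp_minus_linear_le:
  fixes x X k :: real
  assumes "0 \<le> x" "x \<le> X" "0 \<le> k"
  shows "exp x - x \<le> 1 + x\<^sup>2 + exp X * x powr k"
proof (cases "x \<le> 1")
  case True
  then show ?thesis using exp_bound[of x] assms by (simp add: add_increasing2)
next
  case False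
  then have "exp x * 1 \<le> exp X * x powr k"
    using assms by (intro mult_mono ge_one_powr_ge_zero) auto
  then show ?thesis using assms by (smt (verit) zero_le_power2)
qed

lemma power_mean_sum:
  fixes a :: "'a \<Rightarrow> real"
  assumes A: "finite A" and a: "\<And>i. i \<in> A \<Longrightarrow> 0 \<le> a i" and p: "1 \<le> p"
  shows "(\<Sum>i\<in>A. a i) powr p \<le> real (card A) powr (p - 1) * (\<Sum>i\<in>A. a i powr p)"
proof -
  \<comment> \<open>Jensen's inequality is applied to positive arguments only; zero terms contribute
    nothing to either sum, and dropping them only lowers the cardinality.\<close>
  define S where "S = {i \<in> A. a i > 0}"
  have S: "finite S" "S \<subseteq> A" using A by (auto simp: S_def)
  have sumS: "(\<Sum>i\<in>A. a i) = (\<Sum>i\<in>S. a i)" "(\<Sum>i\<in>A. a i powr p) = (\<Sum>i\<in>S. a i powr p)"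
    using A a by (auto simp: S_def less_le intro!: sum.mono_neutral_right)
  show ?thesis
  proof (cases "S = {}")
    case True
    then show ?thesis using sumS by simp
  next
    case False
    define n where "n = real (card S)"
    have n: "0 < n" using False S by (auto simp: n_def card_gt_0_iff)
    have "(\<Sum>i\<in>S. (1 / n) *\<^sub>R a i) powr p \<le> (\<Sum>i\<in>S. (1 / n) * a i powr p)"
      using n S False by (intro convex_on_sum[OF _ _ powr_convex[OF p]]) (auto simp: n_def S_def)
    then have "((1 / n) * (\<Sum>i\<in>S. a i)) powr p \<le> (1 / n) * (\<Sum>i\<in>S. a i powr p)"
      by (simp add: sum_distrib_left)
    then have "(1 / n) powr p * (\<Sum>i\<in>S. a i) powr p \<le> (1 / n) * (\<Sum>i\<in>S. a i powr p)"
      using n by (subst (asm) powr_mult) (auto simp: S_def intro: sum_nonneg)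
    then have "n powr p * ((1 / n) powr p * (\<Sum>i\<in>S. a i) powr p)
        \<le> n powr p * ((1 / n) * (\<Sum>i\<in>S. a i powr p))"
      by (intro mult_left_mono) auto
    then have "(\<Sum>i\<in>S. a i) powr p \<le> n powr (p - 1) * (\<Sum>i\<in>S. a i powr p)"
      using n by (simp add: powr_divide powr_diff)
    also have "\<dots> \<le> real (card A) powr (p - 1) * (\<Sum>i\<in>S. a i powr p)"
      using p A S n by (intro mult_right_mono powr_mono2 sum_nonneg) (auto simp: n_def card_mono)
    finally show ?thesis using sumS by simp
  qed
qed

text \<open>This is \<open>y \<le> exp y\<close> at \<open>y = x / (2 * k)\<close>, raised to the
  power \<open>k\<close>.\<close>

lemma powr_le_exp_half:
  fixes x k :: real
  assumes "0 \<le> x" "0 < k"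
  shows "x powr k \<le> (2 * k) powr k * exp (x / 2)"
proof -
  have "x / (2 * k) \<le> exp (x / (2 * k))"
    using exp_ge_add_one_self[of "x / (2 * k)"] by linarith
  then have "x \<le> 2 * k * exp (x / (2 * k))"
    using assms by (simp add: field_simps)
  then have "x powr k \<le> (2 * k * exp (x / (2 * k))) powr k"
    using assms by (intro powr_mono2) auto
  also have "\<dots> = (2 * k) powr k * exp (x / 2)"
    using assms by (simp add: powr_mult exp_powr_real)
  finally show ?thesis .
qed

section \<open>Truncation and the pointwise one-step inequality\<close>

definition truncate_Rd :: "nat \<Rightarrow> real \<Rightarrow> (nat \<Rightarrow> real) \<Rightarrow> nat \<Rightarrow> real" where
  "truncate_Rd d s y = (\<lambda>j. if L2_set y {..<d} \<le> s then y j else 0)"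

lemma abs_sum_mult_le_L2_set:
  "\<bar>\<Sum>i\<in>A. f i * g i\<bar> \<le> L2_set f A * L2_set g A"
  using sum_abs[of "\<lambda>i. f i * g i" A] L2_set_mult_ineq[of f g A] by (simp add: abs_mult)

lemma L2_set_power2: "(L2_set f A)\<^sup>2 = (\<Sum>i\<in>A. (f i)\<^sup>2)"
  by (simp add: L2_set_def sum_nonneg)

lemma L2_set_add_power2:
  "(L2_set (\<lambda>i. f i + g i) A)\<^sup>2 = (L2_set f A)\<^sup>2 + (L2_set g A)\<^sup>2 + 2 * (\<Sum>i\<in>A. f i * g i)"
  unfolding L2_set_power2 by (simp add: power2_sum sum.distrib sum_distrib_left mult.assoc)

text \<open>The last summand is linear in \<open>y\<close>, not in the truncation of \<open>y\<close>, so it has mean zero; the term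
  with \<open>s powr (k - 1)\<close> pays for the replacement.\<close>

lemma cosh_L2_set_truncate_le:
  fixes l s k :: real and x y :: "nat \<Rightarrow> real" and d :: nat
  assumes l: "0 \<le> l" and s: "0 < s" and k: "1 \<le> k"
  defines "a \<equiv> l * L2_set x {..<d}" and "N \<equiv> L2_set y {..<d}"
  shows "cosh (l * L2_set (\<lambda>j. x j + truncate_Rd d s y j) {..<d})
    \<le> cosh a * (1 + l\<^sup>2 * N\<^sup>2 + (exp (l * s) * l powr k + l / s powr (k - 1)) * N powr k)
      + sinh a / a * l\<^sup>2 * (\<Sum>j<d. x j * y j)"
proof (cases "N \<le> s")
  case True
  define w where "w = l\<^sup>2 * (\<Sum>j<d. x j * y j)"
  have N0: "0 \<le> N" and a0: "0 \<le> a" using l by (auto simp: N_def a_def)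
  have "\<bar>w\<bar> \<le> l\<^sup>2 * (L2_set x {..<d} * L2_set y {..<d})"
    unfolding w_def abs_mult using abs_sum_mult_le_L2_set[of x y] by (auto intro!: mult_left_mono)
  also have "\<dots> = a * (l * N)" by (simp add: a_def N_def power2_eq_square)
  finally have w: "\<bar>w\<bar> \<le> a * (l * N)" .
  have "cosh (l * L2_set (\<lambda>j. x j + y j) {..<d}) \<le> cosh a * (exp (l * N) - l * N) + sinh a / a * w"
  proof (rule cosh_chord[OF _ _ _ w])
    show "(l * L2_set (\<lambda>j. x j + y j) {..<d})\<^sup>2 = a\<^sup>2 + (l * N)\<^sup>2 + 2 * w"
      by (simp add: power_mult_distrib L2_set_add_power2 a_def N_def w_def algebra_simps)
  qed (use l N0 a0 in auto)
  also have "exp (l * N) - l * N \<le> 1 + (l * N)\<^sup>2 + exp (l * s) * (l * N) powr k"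
    using True l N0 k by (intro exp_minus_linear_le mult_left_mono) auto
  also have "\<dots> \<le> 1 + l\<^sup>2 * N\<^sup>2 + (exp (l * s) * l powr k + l / s powr (k - 1)) * N powr k"
    using l N0 by (simp add: powr_mult power_mult_distrib distrib_right)
  finally show ?thesis
    using True by (simp add: truncate_Rd_def N_def[symmetric] w_def mult.assoc)
next
  case False
  then have N: "s < N" by simp
  have a0: "0 \<le> a" using l by (auto simp: a_def)
  \<comment> \<open>The truncated vector is zero, so the left side is just \<open>cosh a\<close>,
    but the linear term in the untruncated \<open>y\<close> may be negative. Cauchy-Schwarz bounds
    its size by \<open>cosh a * (l * N)\<close>.\<close>
  have "- (sinh a / a * l\<^sup>2 * (\<Sum>j<d. x j * y j)) \<le> sinh a / a * l\<^sup>2 * \<bar>\<Sum>j<d. x j * y j\<bar>"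
    using a0 by (cases "(\<Sum>j<d. x j * y j) \<ge> 0") auto
  also have "\<dots> \<le> sinh a / a * l\<^sup>2 * (L2_set x {..<d} * L2_set y {..<d})"
    using a0 by (intro mult_left_mono abs_sum_mult_le_L2_set) auto
  also have "\<dots> = sinh a / a * a * (l * N)"
    by (simp add: a_def N_def power2_eq_square)
  also have "\<dots> \<le> cosh a * (l * N)"
    using l N s sinh_le_cosh_real[of a] by (intro mult_right_mono) auto
  \<comment> \<open>Because \<open>N\<close> exceeds \<open>s\<close>, a first power is traded for a
    moment of order \<open>k\<close>.\<close>
  also have "N \<le> N powr k / s powr (k - 1)"
  proof -
    have "N * s powr (k - 1) \<le> N * N powr (k - 1)"
      using N s k by (intro mult_left_mono powr_mono2) auto
    also have "\<dots> = N powr k" using N s by (simp add: powr_diff)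
    finally show ?thesis using s by (simp add: field_simps)
  qed
  finally have "- (sinh a / a * l\<^sup>2 * (\<Sum>j<d. x j * y j)) \<le> cosh a * (l / s powr (k - 1) * N powr k)"
    using l by (simp add: mult_left_mono)
  moreover have "0 \<le> cosh a * (l\<^sup>2 * N\<^sup>2)" "0 \<le> cosh a * (exp (l * s) * l powr k * N powr k)"
    by auto
  ultimately show ?thesis
    using N by (simp add: truncate_Rd_def N_def[symmetric] a_def[symmetric] distrib_left distrib_right)
qed

section \<open>Moments of a single sample\<close>

locale centered_moment_bounded = prob_space D
  for D :: "(nat \<Rightarrow> real) measure" +
  fixes d :: nat and k :: real
  assumes sets_D: "sets D = sets (Rd d)"
    and centered: "has_mean_zero d D"
    and k_gt_2: "2 < k"
    and d_pos: "0 < d"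
    and coordinate_moment: "\<And>i. i < d \<Longrightarrow> (\<integral>\<^sup>+y. ennreal (\<bar>y i\<bar> powr k) \<partial>D) \<le> 1"
begin

lemma measurable_coordinate [measurable]: "i < d \<Longrightarrow> (\<lambda>y. y i) \<in> borel_measurable D"
  unfolding measurable_cong_sets[OF sets_D refl] Rd_def by measurable

lemma measurable_L2_set [measurable]: "(\<lambda>y. L2_set y {..<d}) \<in> borel_measurable D"
  unfolding L2_set_def by measurable

lemma measurable_truncate_Rd [measurable]:
  "i < d \<Longrightarrow> (\<lambda>y. truncate_Rd d s y i) \<in> borel_measurable D"
  unfolding truncate_Rd_def by measurable

lemma coordinate_powr:
  assumes "i < d"
  shows "integrable D (\<lambda>y. \<bar>y i\<bar> powr k)" and "expectation (\<lambda>y. \<bar>y i\<bar> powr k) \<le> 1"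
proof -
  show *: "integrable D (\<lambda>y. \<bar>y i\<bar> powr k)"
    using assms coordinate_moment[OF assms]
    by (intro integrableI_nonneg) (auto intro: le_less_trans[OF _ ennreal_one_less_top])
  show "expectation (\<lambda>y. \<bar>y i\<bar> powr k) \<le> 1"
    using coordinate_moment[OF assms] nn_integral_eq_integral[OF *] by simp
qed

text \<open>The power mean inequality with exponent \<open>k / 2\<close> on the \<open>d\<close>
  squared coordinates costs \<open>d powr (k / 2 - 1)\<close>; summing \<open>d\<close> coordinate
  moments supplies the missing factor \<open>d\<close>.\<close>

lemma L2_set_powr:
  shows "integrable D (\<lambda>y. L2_set y {..<d} powr k)"
    and "expectation (\<lambda>y. L2_set y {..<d} powr k) \<le> real d powr (k / 2)"
proof -
  let ?g = "\<lambda>y. real d powr (k / 2 - 1) * (\<Sum>i<d. \<bar>y i\<bar> powr k)"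
  have le: "L2_set y {..<d} powr k \<le> ?g y" for y :: "nat \<Rightarrow> real"
  proof -
    have "L2_set y {..<d} powr k = (\<Sum>i<d. (y i)\<^sup>2) powr (k / 2)"
      by (simp add: L2_set_def powr_half_sqrt[symmetric] sum_nonneg powr_powr)
    also have "\<dots> \<le> real (card {..<d}) powr (k / 2 - 1) * (\<Sum>i<d. (y i)\<^sup>2 powr (k / 2))"
      using k_gt_2 by (intro power_mean_sum) auto
    also have "(\<lambda>i. (y i)\<^sup>2 powr (k / 2)) = (\<lambda>i. \<bar>y i\<bar> powr k)"
    proof
      fix i show "(y i)\<^sup>2 powr (k / 2) = \<bar>y i\<bar> powr k"
        using powr_powr[of "\<bar>y i\<bar>" 2 "k / 2"] by (cases "y i = 0") auto
    qed
    finally show ?thesis by simp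
  qed
  have g: "integrable D ?g" using coordinate_powr by auto
  show int: "integrable D (\<lambda>y. L2_set y {..<d} powr k)"
    by (rule Bochner_Integration.integrable_bound[OF g]) (auto intro!: order_trans[OF le] abs_ge_self)
  have "expectation (\<lambda>y. L2_set y {..<d} powr k) \<le> expectation ?g"
    using int g le by (intro integral_mono) auto
  also have "\<dots> = real d powr (k / 2 - 1) * (\<Sum>i<d. expectation (\<lambda>y. \<bar>y i\<bar> powr k))"
    using coordinate_powr by (simp add: Bochner_Integration.integral_sum)
  also have "\<dots> \<le> real d powr (k / 2 - 1) * (\<Sum>i<d. 1)"
    using coordinate_powr by (intro mult_left_mono sum_mono) auto
  also have "\<dots> = real d powr (k / 2)" using d_pos by (simp add: powr_diff)
  finally show "expectation (\<lambda>y. L2_set y {..<d} powr k) \<le> real d powr (k / 2)" .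
qed

text \<open>The crude bound \<open>v\<^sup>2 \<le> 1 + \<bar>v\<bar> powr k\<close> gives both
  integrability and a second moment of at most \<open>2\<close> per coordinate.\<close>

lemma L2_set_square:
  shows "integrable D (\<lambda>y. (L2_set y {..<d})\<^sup>2)"
    and "expectation (\<lambda>y. (L2_set y {..<d})\<^sup>2) \<le> 2 * real d"
proof -
  let ?g = "\<lambda>y. \<Sum>i<d. 1 + \<bar>y i\<bar> powr k"
  have le1: "v\<^sup>2 \<le> 1 + \<bar>v\<bar> powr k" for v :: real
  proof (cases "\<bar>v\<bar> \<le> 1")
    case True
    then show ?thesis by (simp add: abs_square_le_1 add_increasing2)
  next
    case False
    then have "\<bar>v\<bar> powr 2 \<le> \<bar>v\<bar> powr k" using k_gt_2 by (intro powr_mono) auto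
    then show ?thesis using False by simp
  qed
  have le: "(L2_set y {..<d})\<^sup>2 \<le> ?g y" for y :: "nat \<Rightarrow> real"
    unfolding L2_set_power2 by (intro sum_mono le1)
  have g: "integrable D ?g" using coordinate_powr by auto
  show int: "integrable D (\<lambda>y. (L2_set y {..<d})\<^sup>2)"
    by (rule Bochner_Integration.integrable_bound[OF g]) (auto intro!: order_trans[OF le] abs_ge_self)
  have "expectation (\<lambda>y. (L2_set y {..<d})\<^sup>2) \<le> expectation ?g"
    using int g le by (intro integral_mono) auto
  also have "\<dots> = (\<Sum>i<d. 1 + expectation (\<lambda>y. \<bar>y i\<bar> powr k))"
    using coordinate_powr by (simp add: Bochner_Integration.integral_sum prob_space)
  also have "\<dots> \<le> (\<Sum>i<d. 2)"
    using coordinate_powr by (intro sum_mono) auto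
  finally show "expectation (\<lambda>y. (L2_set y {..<d})\<^sup>2) \<le> 2 * real d" by simp
qed

section \<open>Cosh moments of the truncated sum\<close>

definition growth :: "real \<Rightarrow> real \<Rightarrow> real" where
  "growth l s = 2 * l\<^sup>2 * real d
    + (exp (l * s) * l powr k + l / s powr (k - 1)) * real d powr (k / 2)"

lemma growth_nonneg: "0 \<le> l \<Longrightarrow> 0 \<le> growth l s"
  by (auto simp: growth_def intro!: add_nonneg_nonneg)

text \<open>Integrating the pointwise inequality removes its linear term, as the untruncated sample
  is centered. The three contributions to \<open>growth\<close> are the variance, the exponential
  remainder and the bias of the truncation.\<close>

lemma nn_integral_cosh_truncate_le:
  assumes l: "0 \<le> l" and s: "0 < s"
  shows "(\<integral>\<^sup>+y. ennreal (cosh (l * L2_set (\<lambda>j. x j + truncate_Rd d s y j) {..<d})) \<partial>D)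
    \<le> ennreal (1 + growth l s) * ennreal (cosh (l * L2_set x {..<d}))"
proof -
  define a where "a = l * L2_set x {..<d}"
  define c where "c = exp (l * s) * l powr k + l / s powr (k - 1)"
  let ?N = "\<lambda>y. L2_set y {..<d}"
  let ?g = "\<lambda>y. cosh a * (1 + l\<^sup>2 * (?N y)\<^sup>2 + c * ?N y powr k)
      + sinh a / a * l\<^sup>2 * (\<Sum>j<d. x j * y j)"
  have coord: "integrable D (\<lambda>y. y j)" "expectation (\<lambda>y. y j) = 0" if "j < d" for j
    using centered that by (auto simp: has_mean_zero_def mean_Rd_def)
  have lin: "integrable D (\<lambda>y. \<Sum>j<d. x j * y j)" "expectation (\<lambda>y. \<Sum>j<d. x j * y j) = 0"
    using coord by (auto simp: Bochner_Integration.integral_sum)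
  have c: "0 \<le> c" using l by (auto simp: c_def)
  have le: "cosh (l * L2_set (\<lambda>j. x j + truncate_Rd d s y j) {..<d}) \<le> ?g y" for y
    using cosh_L2_set_truncate_le[OF l s, where k=k and d=d and x=x and y=y] k_gt_2 by (simp add: a_def c_def)
  have int: "integrable D ?g"
    using L2_set_square(1) L2_set_powr(1) lin(1)
    by (intro Bochner_Integration.integrable_add integrable_mult_right integrable_const) auto
  have g0: "0 \<le> ?g y" for y
    by (rule order_trans[OF _ le]) (simp add: cosh_real_nonneg)
  have "(\<integral>\<^sup>+y. ennreal (cosh (l * L2_set (\<lambda>j. x j + truncate_Rd d s y j) {..<d})) \<partial>D)
      \<le> (\<integral>\<^sup>+y. ennreal (?g y) \<partial>D)"
    by (intro nn_integral_mono ennreal_leI le)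
  also have "\<dots> = ennreal (expectation ?g)"
    using g0 by (intro nn_integral_eq_integral[OF int]) auto
  also have "expectation ?g = cosh a * (1 + l\<^sup>2 * expectation (\<lambda>y. (?N y)\<^sup>2)
      + c * expectation (\<lambda>y. ?N y powr k))"
    using L2_set_square(1) L2_set_powr(1) lin
    by (simp add: prob_space del: times_divide_eq_left)
  also have "\<dots> \<le> cosh a * (1 + l\<^sup>2 * (2 * real d) + c * real d powr (k / 2))"
    using c L2_set_square(2) L2_set_powr(2)
    by (intro mult_left_mono add_mono) (auto simp: cosh_real_nonneg)
  also have "\<dots> = (1 + growth l s) * cosh a"
    by (simp add: growth_def c_def)
  finally show ?thesis
    using growth_nonneg[OF l] by (simp add: a_def ennreal_mult cosh_real_nonneg ennreal_leI)
qed

lemma measurable_iid_component: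
  assumes "f \<in> borel_measurable D" "i < n"
  shows "(\<lambda>X. f (X i)) \<in> borel_measurable (iid_samples n D)"
  unfolding iid_samples_def
  by (rule measurable_compose[where N=D and f="\<lambda>X. X i" and g=f])
     (use assms in auto)

lemma measurable_truncated_sum [measurable]:
  "(\<lambda>X. L2_set (\<lambda>j. \<Sum>i<n. truncate_Rd d s (X i) j) {..<d}) \<in> borel_measurable (iid_samples n D)"
  unfolding L2_set_def
  by (rule measurable_compose[OF _ borel_measurable_sqrt])
     (intro borel_measurable_sum borel_measurable_power measurable_iid_component
      measurable_truncate_Rd; simp)

text \<open>Fubini integrates out the last sample first, with the partial sum of the others as the
  fixed vector \<open>x\<close>; each sample costs one factor \<open>1 + growth l s\<close>.\<close>

lemma nn_integral_cosh_truncated_sum_le: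
  assumes l: "0 \<le> l" and s: "0 < s"
  shows "(\<integral>\<^sup>+X. ennreal (cosh (l * L2_set (\<lambda>j. \<Sum>i<n. truncate_Rd d s (X i) j) {..<d})) \<partial>iid_samples n D)
    \<le> ennreal (1 + growth l s) ^ n"
proof (induction n)
  case 0
  then show ?case by (simp add: iid_samples_def L2_set_0' PiM_empty nn_integral_count_space_finite)
next
  case (Suc n)
  interpret product_sigma_finite "\<lambda>_. D" ..
  let ?f = "\<lambda>n X. ennreal (cosh (l * L2_set (\<lambda>j. \<Sum>i<n. truncate_Rd d s (X i) j) {..<d}))"
  have meas: "?f n \<in> borel_measurable (iid_samples n D)" for n
    unfolding cosh_def by measurable
  have "(\<integral>\<^sup>+X. ?f (Suc n) X \<partial>iid_samples (Suc n) D)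
      = (\<integral>\<^sup>+X. \<integral>\<^sup>+y. ?f (Suc n) (X(n := y)) \<partial>D \<partial>iid_samples n D)"
    using meas[of "Suc n"] unfolding iid_samples_def lessThan_Suc
    by (intro product_nn_integral_insert) auto
  also have "\<dots> = (\<integral>\<^sup>+X. \<integral>\<^sup>+y. ennreal (cosh (l * L2_set (\<lambda>j. (\<Sum>i<n. truncate_Rd d s (X i) j)
      + truncate_Rd d s y j) {..<d})) \<partial>D \<partial>iid_samples n D)"
    by simp
  also have "\<dots> \<le> (\<integral>\<^sup>+X. ennreal (1 + growth l s) * ?f n X \<partial>iid_samples n D)"
    by (intro nn_integral_mono nn_integral_cosh_truncate_le assms)
  also have "\<dots> = ennreal (1 + growth l s) * (\<integral>\<^sup>+X. ?f n X \<partial>iid_samples n D)"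
    using meas by (rule nn_integral_cmult)
  also have "\<dots> \<le> ennreal (1 + growth l s) ^ Suc n"
    using Suc.IH by (simp add: mult_left_mono)
  finally show ?case .
qed

section \<open>Tail bounds for one sample and for the sample mean\<close>

lemma prob_L2_set_gt:
  assumes "0 < s"
  shows "\<P>(y in D. s < L2_set y {..<d}) \<le> real d powr (k / 2) / s powr k"
proof -
  have "\<P>(y in D. s < L2_set y {..<d}) \<le> \<P>(y in D. s powr k \<le> L2_set y {..<d} powr k)"
    using assms k_gt_2 by (intro finite_measure_mono) (auto intro: powr_mono2 less_imp_le)
  also have "\<dots> \<le> expectation (\<lambda>y. L2_set y {..<d} powr k) / s powr k"
    using assms L2_set_powr(1) by (intro integral_Markov_inequality_measure[where A="{}"]) auto
  also have "\<dots> \<le> real d powr (k / 2) / s powr k"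
    using L2_set_powr(2) by (intro divide_right_mono) auto
  finally show ?thesis .
qed

lemma prob_sample_mean_ge:
  assumes m: "0 < m" and t: "0 < t" and l: "0 \<le> l" and s: "0 < s"
  shows "\<P>(X in iid_samples m D. t \<le> L2_set (sample_mean m X) {..<d})
    \<le> real m * (real d powr (k / 2) / s powr k) + (1 + growth l s) ^ m / cosh (l * (real m * t))"
proof -
  let ?P = "iid_samples m D"
  interpret P: prob_space ?P
    unfolding iid_samples_def by (intro prob_space_PiM) unfold_locales
  define S where "S X = L2_set (\<lambda>j. \<Sum>i<m. truncate_Rd d s (X i) j) {..<d}" for X
  have S [measurable]: "S \<in> borel_measurable ?P" unfolding S_def by measurable
  define A where "A i = {X \<in> space ?P. s < L2_set (X i) {..<d}}" for i
  \<comment> \<open>Comparing values of cosh instead of norms makes Markov's inequality apply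
    directly and also covers \<open>l = 0\<close>, where \<open>B\<close> is the whole
    space.\<close>
  define B where "B = {X \<in> space ?P. cosh (l * (real m * t)) \<le> cosh (l * S X)}"
  have A: "A i \<in> P.events" if "i < m" for i
    using measurable_iid_component[OF measurable_L2_set that] unfolding A_def by measurable
  have B: "B \<in> P.events" unfolding B_def cosh_def by measurable
  have PA: "P.prob (A i) \<le> real d powr (k / 2) / s powr k" if "i < m" for i
  proof -
    have "\<P>(y in D. s < L2_set y {..<d})
        = \<P>(y in distr ?P D (\<lambda>X. X i). s < L2_set y {..<d})"
      using that unfolding iid_samples_def by (subst distr_PiM_component) (auto simp: prob_space_axioms)
    also have "\<dots> = P.prob (A i)"
      using that by (subst measure_distr)
        (auto simp: A_def iid_samples_def space_PiM intro!: arg_cong[where f="measure _"])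
    finally show ?thesis using prob_L2_set_gt[OF s] by simp
  qed
  have PB: "P.prob B \<le> (1 + growth l s) ^ m / cosh (l * (real m * t))"
  proof -
    have ch: "0 < cosh (l * (real m * t))" by (rule cosh_real_pos)
    have "emeasure ?P B \<le> ennreal (1 / cosh (l * (real m * t))) * (\<integral>\<^sup>+X. ennreal (cosh (l * S X)) \<partial>?P)"
    proof -
      have "B = {X \<in> space ?P. 1 \<le> ennreal (1 / cosh (l * (real m * t))) * ennreal (cosh (l * S X))}"
        using ch by (auto simp: B_def ennreal_mult[symmetric] field_simps cosh_real_nonneg)
      also have "emeasure ?P \<dots> \<le> ennreal (1 / cosh (l * (real m * t)))
          * (\<integral>\<^sup>+X. ennreal (cosh (l * S X)) * indicator (space ?P) X \<partial>?P)"
        by (rule nn_integral_Markov_inequality) (auto simp: cosh_def)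
      finally show ?thesis
        by (simp add: nn_integral_cong[of ?P "\<lambda>X. ennreal (cosh (l * S X)) * indicator (space ?P) X"
              "\<lambda>X. ennreal (cosh (l * S X))"])
    qed
    also have "\<dots> \<le> ennreal (1 / cosh (l * (real m * t))) * ennreal (1 + growth l s) ^ m"
      unfolding S_def by (intro mult_left_mono nn_integral_cosh_truncated_sum_le l s) auto
    also have "\<dots> = ennreal ((1 + growth l s) ^ m / cosh (l * (real m * t)))"
      using growth_nonneg[OF l, of s] ch
      by (simp add: ennreal_power ennreal_mult[symmetric] del: ennreal_plus)
    finally show ?thesis
      using growth_nonneg[OF l, of s] ch by (simp add: P.emeasure_eq_measure)
  qed
  have "{X \<in> space ?P. t \<le> L2_set (sample_mean m X) {..<d}} \<subseteq> (\<Union>i<m. A i) \<union> B"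
  proof
    fix X assume X: "X \<in> {X \<in> space ?P. t \<le> L2_set (sample_mean m X) {..<d}}"
    show "X \<in> (\<Union>i<m. A i) \<union> B"
    proof (cases "\<exists>i<m. s < L2_set (X i) {..<d}")
      case True
      then show ?thesis using X by (auto simp: A_def)
    next
      case False
      then have "(\<Sum>i<m. X i j) = (\<Sum>i<m. truncate_Rd d s (X i) j)" for j
        by (intro sum.cong) (auto simp: truncate_Rd_def)
      \<comment> \<open>When no sample is longer than \<open>s\<close>, truncation changes nothing,
        so the norm of the mean is that of the truncated sum divided by \<open>m\<close>.\<close>
      then have "L2_set (sample_mean m X) {..<d} = (1 / real m) * S X"
        unfolding sample_mean_def S_def by (subst L2_set_right_distrib) auto
      then have "real m * L2_set (sample_mean m X) {..<d} = S X"
        using m by simp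
      moreover have "real m * t \<le> real m * L2_set (sample_mean m X) {..<d}"
        using X by (intro mult_left_mono) auto
      ultimately have "l * (real m * t) \<le> l * S X"
        using l by (intro mult_left_mono) auto
      then have "cosh (l * (real m * t)) \<le> cosh (l * S X)"
        using l t by (subst cosh_real_nonneg_le_iff) (auto simp: S_def)
      then show ?thesis using X by (auto simp: B_def)
    qed
  qed
  then have "\<P>(X in ?P. t \<le> L2_set (sample_mean m X) {..<d}) \<le> P.prob ((\<Union>i<m. A i) \<union> B)"
    using A B by (intro P.finite_measure_mono) auto
  also have "\<dots> \<le> P.prob (\<Union>i<m. A i) + P.prob B"
    using A B by (intro measure_Un_le) auto
  also have "P.prob (\<Union>i<m. A i) \<le> (\<Sum>i<m. P.prob (A i))"
    using A by (intro measure_UNION_le) auto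
  also have "\<dots> \<le> (\<Sum>i<m. real d powr (k / 2) / s powr k)"
    using PA by (intro sum_mono) auto
  finally show ?thesis using PB by simp
qed

text \<open>The summand \<open>2 powr k\<close> comes from the long samples. The exponent adds up
  the bounds on \<open>m\<close> times each of the three terms of \<open>growth\<close>.\<close>

lemma prob_sample_mean_ge_polynomial:
  assumes m: "0 < m" and t: "sqrt (real d) \<le> t"
  shows "\<P>(X in iid_samples m D. t \<le> L2_set (sample_mean m X) {..<d})
    \<le> (2 powr k + 2 * exp (8 * k\<^sup>2 + (2 * k) powr k + 2 powr (k - 1)))
      * (real d powr (k / 2) / (real m powr (k - 1) * t powr k))"
    (is "?prob \<le> (_ + 2 * exp ?E) * ?\<delta>")
proof -
  interpret P: prob_space "iid_samples m D"
    unfolding iid_samples_def by (intro prob_space_PiM) unfold_locales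
  have d0: "0 < sqrt (real d)" using d_pos by simp
  then have t0: "0 < t" using t by linarith
  have m1: "1 \<le> real m" using m by simp
  define r where "r = real m * t"
  have r0: "0 < r" using m t0 by (simp add: r_def)
  have \<delta>: "?\<delta> = real m * real d powr (k / 2) / r powr k"
    using m t0 by (simp add: r_def powr_mult powr_diff)
  have \<delta>0: "0 < ?\<delta>" using m t0 d_pos by simp
  show ?thesis
  proof (cases "?\<delta> \<le> 1")
    \<comment> \<open>A bound above \<open>1\<close> is trivial for a probability, so
      \<open>?\<delta> \<le> 1\<close> and hence \<open>L \<ge> 0\<close> may be assumed
      afterwards.\<close>
    case False
    have "?prob \<le> 1" by simp
    also have "\<dots> \<le> 2 * exp ?E * ?\<delta>"
      using False by (intro mult_ge1_I) (auto intro: order_trans[of 1 "exp _"])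
    also have "\<dots> \<le> (2 powr k + 2 * exp ?E) * ?\<delta>"
      using \<delta>0 by (intro mult_right_mono) auto
    finally show ?thesis .
  next
    case True
    \<comment> \<open>These choices give \<open>l * (m * t) = L\<close> and
      \<open>l * s = L / 2\<close>. Markov's inequality then gains \<open>1 / cosh L\<close>, of
      order \<open>?\<delta>\<close>, while \<open>exp (l * s)\<close> is only
      \<open>?\<delta>\<close> to the power \<open>- 1 / 2\<close>.\<close>
    define L where "L = - ln ?\<delta>"
    define l where "l = L / r"
    define s where "s = r / 2"
    have L0: "0 \<le> L" using True \<delta>0 by (simp add: L_def)
    have eL: "exp (- L) = ?\<delta>" using \<delta>0 by (simp add: L_def)
    have l0: "0 \<le> l" using L0 r0 by (simp add: l_def)
    have s0: "0 < s" using r0 by (simp add: s_def)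
    define u where "u = t / sqrt (real d)"
    have u1: "1 \<le> u" using t d0 by (simp add: u_def)
    \<comment> \<open>In terms of \<open>u\<close>, the inverse of \<open>?\<delta>\<close> is
      \<open>m powr (k - 1) * u powr k\<close>. As \<open>u \<ge> 1\<close>, its logarithm is at
      most \<open>2 * k * ln (sqrt m * u)\<close>, and \<open>ln z \<le> z\<close> finishes.\<close>
    have Lu: "L \<le> 2 * k * (sqrt (real m) * u)"
    proof -
      have "real d powr (k / 2) = sqrt (real d) powr k"
        using d_pos by (simp add: powr_half_sqrt[symmetric] powr_powr)
      then have "?\<delta> = inverse (real m powr (k - 1) * u powr k)"
        using d0 t0 by (simp add: u_def powr_divide field_simps)
      then have "L = ln (real m powr (k - 1) * u powr k)"
        by (simp only: L_def ln_inverse minus_minus)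
      also have "\<dots> = (k - 1) * ln (real m) + k * ln u"
        using m u1 by (simp add: ln_mult ln_powr)
      also have "\<dots> \<le> k * ln (real m) + 2 * k * ln u"
        using m1 u1 k_gt_2 by (intro add_mono mult_right_mono) auto
      also have "\<dots> = 2 * k * ln (sqrt (real m) * u)"
        using m u1 by (simp add: ln_mult ln_sqrt algebra_simps)
      also have "\<dots> \<le> 2 * k * (sqrt (real m) * u)"
        using m u1 k_gt_2 ln_le_minus_one[of "sqrt (real m) * u"] by (intro mult_left_mono) auto
      finally show ?thesis .
    qed
    \<comment> \<open>The variance term equals \<open>2 * L\<^sup>2 / (m * u\<^sup>2)\<close>,
      exactly the scale of the square of \<open>Lu\<close>.\<close>
    have g1: "real m * (2 * l\<^sup>2 * real d) \<le> 8 * k\<^sup>2"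
    proof -
      have "L\<^sup>2 \<le> (2 * k * (sqrt (real m) * u))\<^sup>2"
        using Lu L0 by (intro power_mono) auto
      also have "\<dots> = 4 * k\<^sup>2 * (real m * u\<^sup>2)" by (simp add: power_mult_distrib)
      finally have "L\<^sup>2 / (real m * u\<^sup>2) \<le> 4 * k\<^sup>2"
        using m u1 by (simp add: divide_simps)
      moreover have "real m * (2 * l\<^sup>2 * real d) = 2 * (L\<^sup>2 / (real m * u\<^sup>2))"
        using m d_pos t0 by (simp add: l_def r_def u_def power_divide power_mult_distrib power2_eq_square field_simps)
      ultimately show ?thesis by simp
    qed
    \<comment> \<open>This term is \<open>L powr k * exp (- L / 2)\<close>: half of the decay of
      \<open>?\<delta>\<close> is left to absorb the power of \<open>L\<close>.\<close>
    have g2: "real m * (exp (l * s) * l powr k * real d powr (k / 2)) \<le> (2 * k) powr k"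
    proof -
      have "real m * (exp (l * s) * l powr k * real d powr (k / 2)) = exp (L / 2) * L powr k * ?\<delta>"
        using r0 L0 unfolding \<delta> by (simp add: l_def s_def powr_divide)
      also have "\<dots> \<le> exp (L / 2) * ((2 * k) powr k * exp (L / 2)) * ?\<delta>"
        using powr_le_exp_half[OF L0, of k] k_gt_2 \<delta>0 by (intro mult_right_mono mult_left_mono) auto
      also have "\<dots> = (2 * k) powr k * (exp (L / 2) * exp (L / 2) * exp (- L))"
        by (simp add: eL)
      also have "\<dots> = (2 * k) powr k"
        unfolding exp_add[symmetric] by simp
      finally show ?thesis .
    qed
    \<comment> \<open>The bias term is a constant times \<open>L * exp (- L)\<close>.\<close>
    have g3: "real m * (l / s powr (k - 1) * real d powr (k / 2)) \<le> 2 powr (k - 1)"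
    proof -
      have "real m * (l / s powr (k - 1) * real d powr (k / 2)) = 2 powr (k - 1) * (L * ?\<delta>)"
        using r0 unfolding \<delta> by (simp add: l_def s_def powr_divide powr_diff field_simps)
      also have "L * ?\<delta> \<le> 1"
        unfolding eL[symmetric] using order_trans[OF _ exp_ge_add_one_self[of L], of L] by (simp add: exp_minus field_simps)
      finally show ?thesis by simp
    qed
    have "real m * growth l s \<le> ?E"
      using g1 g2 g3 by (simp add: growth_def algebra_simps)
    moreover have "(1 + growth l s) ^ m \<le> exp (real m * growth l s)"
      unfolding exp_of_nat_mult using growth_nonneg[OF l0]
      by (intro power_mono exp_ge_add_one_self) auto
    ultimately have num: "(1 + growth l s) ^ m \<le> exp ?E" by (meson exp_le_cancel_iff order_trans)
    have lr: "l * (real m * t) = L" using m t0 by (simp add: l_def r_def)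
    have "inverse (cosh L) \<le> 2 * ?\<delta>"
    proof -
      have "inverse (cosh L) \<le> inverse (exp L / 2)"
        by (rule le_imp_inverse_le) (simp_all add: cosh_def)
      then show ?thesis unfolding eL[symmetric] by (simp add: exp_minus field_simps)
    qed
    then have "(1 + growth l s) ^ m / cosh L \<le> exp ?E * (2 * ?\<delta>)"
      unfolding divide_inverse using num by (intro mult_mono) (auto simp: cosh_real_nonneg)
    moreover have "real m * (real d powr (k / 2) / s powr k) = 2 powr k * ?\<delta>"
      using r0 unfolding \<delta> by (simp add: s_def powr_divide)
    ultimately show ?thesis
      using prob_sample_mean_ge[OF m t0 l0 s0] unfolding lr by (simp add: algebra_simps)
  qed
qed

end

section \<open>From \<open>sigma_k\<close> to coordinate moments, and the conclusion\<close>

lemma coordinate_moment_le_1: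
  assumes D: "has_mean_zero d D" and k: "0 < k" and sigma: "sigma_k k d D \<le> 1" and i: "i < d"
  shows "(\<integral>\<^sup>+y. ennreal (\<bar>y i\<bar> powr k) \<partial>D) \<le> 1"
proof -
  \<comment> \<open>The supremum is tested at a standard basis vector. An infinite moment is
    excluded because \<open>ennpowr\<close> maps infinity to itself.\<close>
  let ?v = "\<lambda>j. if j = i then 1 else 0 :: real"
  let ?I = "\<integral>\<^sup>+y. ennreal (\<bar>y i\<bar> powr k) \<partial>D"
  have "inner_Rd d (\<lambda>j. y j - mean_Rd D j) ?v = y i" for y
    using D i by (simp add: inner_Rd_def has_mean_zero_def if_distrib cong: if_cong)
  moreover have "L2_set ?v {..<d} = 1"
    using i by (simp add: L2_set_def if_distrib[of "\<lambda>z. z ^ 2"] cong: if_cong)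
  ultimately have "ennpowr ?I (1 / k) \<le> sigma_k k d D"
    unfolding sigma_k_def by (intro SUP_upper2[of ?v]) auto
  then have le: "ennpowr ?I (1 / k) \<le> 1" using sigma by simp
  then have fin: "?I \<noteq> \<infinity>" by (auto simp: ennpowr_def top_unique)
  then have "enn2real ?I powr (1 / k) \<le> 1" using le by (simp add: ennpowr_def)
  then have "(enn2real ?I powr (1 / k)) powr k \<le> 1 powr k"
    using k by (intro powr_mono2) auto
  then have "enn2real ?I \<le> 1" using k by (simp add: powr_powr)
  then show ?thesis using fin by (metis ennreal_1 ennreal_enn2real ennreal_leI infinity_ennreal_def top.not_eq_extremum)
qed

theorem theorem4p6:
  shows "\<exists>C::real. \<forall>k::real. k > 2 \<longrightarrow>
    (\<exists>(K::real) (c::real). \<forall>(d::nat) (m::nat) (D :: (nat \<Rightarrow> real) measure).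
      d \<ge> 1 \<longrightarrow> m \<ge> 1 \<longrightarrow>
      distribution_on_Rd d D \<longrightarrow> has_mean_zero d D \<longrightarrow> sigma_k k d D \<le> 1 \<longrightarrow>
      (\<exists>t3::real. 0 \<le> t3 \<and> t3 \<le> C * (sqrt (real d) * ln (real m) powr (1 / k)) \<and>
        (\<forall>t::real. t > 0 \<longrightarrow> t \<ge> t3 \<longrightarrow>
          \<P>(X in iid_samples m D. L2_set (sample_mean m X) {..<d} \<ge> t)
            \<le> K * (1 + ln (real m)) powr c *
                (real d powr (k / 2) / (real m powr (k - 1) * t powr k)))))"
proof (rule exI[of _ 2], intro allI impI)
  fix k :: real
  assume k: "k > 2"
  define K where "K = 2 powr k + 2 * exp (8 * k\<^sup>2 + (2 * k) powr k + 2 powr (k - 1))"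
  have K1: "1 \<le> K" using k by (auto simp: K_def intro!: add_increasing2 ge_one_powr_ge_zero)
  show "\<exists>(K::real) (c::real). \<forall>(d::nat) (m::nat) (D :: (nat \<Rightarrow> real) measure).
      d \<ge> 1 \<longrightarrow> m \<ge> 1 \<longrightarrow>
      distribution_on_Rd d D \<longrightarrow> has_mean_zero d D \<longrightarrow> sigma_k k d D \<le> 1 \<longrightarrow>
      (\<exists>t3::real. 0 \<le> t3 \<and> t3 \<le> 2 * (sqrt (real d) * ln (real m) powr (1 / k)) \<and>
        (\<forall>t::real. t > 0 \<longrightarrow> t \<ge> t3 \<longrightarrow>
          \<P>(X in iid_samples m D. L2_set (sample_mean m X) {..<d} \<ge> t)
            \<le> K * (1 + ln (real m)) powr c *
                (real d powr (k / 2) / (real m powr (k - 1) * t powr k))))"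
  \<comment> \<open>The exponent of the logarithm is \<open>0\<close>.\<close>
  proof (rule exI[of _ K], rule exI[of _ 0], intro allI impI)
    fix d m :: nat and D :: "(nat \<Rightarrow> real) measure"
    assume d: "d \<ge> 1" and m: "m \<ge> 1" and D: "distribution_on_Rd d D" "has_mean_zero d D"
      and sigma: "sigma_k k d D \<le> 1"
    interpret prob_space D using D by (simp add: distribution_on_Rd_def)
    interpret centered_moment_bounded D d k
      using D d k coordinate_moment_le_1[OF D(2) _ sigma]
      by unfold_locales (auto simp: distribution_on_Rd_def)
    interpret P: prob_space "iid_samples m D"
      unfolding iid_samples_def by (intro prob_space_PiM) unfold_locales
    define t3 where "t3 = 2 * (sqrt (real d) * ln (real m) powr (1 / k))"
    have "\<P>(X in iid_samples m D. L2_set (sample_mean m X) {..<d} \<ge> t)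
        \<le> K * (real d powr (k / 2) / (real m powr (k - 1) * t powr k))"
      if t: "t > 0" "t \<ge> t3" for t
    proof (cases "sqrt (real d) \<le> t")
      case True
      then show ?thesis
        using prob_sample_mean_ge_polynomial[of m t] m by (simp add: K_def)
    next
      case False
      \<comment> \<open>For \<open>m \<ge> 2\<close>, \<open>ln m \<ge> 1 / 2\<close> gives
        \<open>2 * ln m powr (1 / k) \<ge> 1\<close>, so the constant \<open>2\<close> in
        \<open>t3\<close> forces \<open>t \<ge> sqrt d\<close>.\<close>
      have "m = 1"
      proof (rule ccontr)
        assume "m \<noteq> 1"
        then have "ln 2 \<le> ln (real m)" using m by simp
        then have "1 / 2 \<le> ln (real m)" using ln2_ge_two_thirds by linarith
        then have "(1 / 2) powr (1 / k) \<le> ln (real m) powr (1 / k)"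
          using k by (intro powr_mono2) auto
        moreover have "(1 / 2) powr 1 \<le> (1 / 2 :: real) powr (1 / k)"
          using k by (intro powr_mono') auto
        ultimately have "1 \<le> 2 * ln (real m) powr (1 / k)" by simp
        then have "sqrt (real d) * 1 \<le> sqrt (real d) * (2 * ln (real m) powr (1 / k))"
          by (intro mult_left_mono) auto
        then show False using False t by (simp add: t3_def mult.left_commute)
      qed
      \<comment> \<open>With \<open>m = 1\<close> and \<open>t\<close> below \<open>sqrt d\<close>,
        the claimed bound is at least \<open>1\<close>.\<close>
      have "t powr k \<le> sqrt (real d) powr k"
        using False t k by (intro powr_mono2) auto
      also have "\<dots> = real d powr (k / 2)"
        using d by (simp add: powr_half_sqrt[symmetric] powr_powr)
      finally have "1 \<le> real d powr (k / 2) / (real m powr (k - 1) * t powr k)"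
        using t by (simp add: \<open>m = 1\<close>)
      then have "1 \<le> K * (real d powr (k / 2) / (real m powr (k - 1) * t powr k))"
        using K1 mult_mono[of 1 K 1] by fastforce
      then show ?thesis using P.prob_le_1 order_trans by blast
    qed
    \<comment> \<open>Needed because \<open>0 powr 0\<close> is \<open>0\<close>, not
      \<open>1\<close>.\<close>
    moreover have "1 + ln (real m) \<noteq> 0" using m by (simp add: add_nonneg_eq_0_iff)
    ultimately show "\<exists>t3::real. 0 \<le> t3 \<and> t3 \<le> 2 * (sqrt (real d) * ln (real m) powr (1 / k)) \<and>
        (\<forall>t::real. t > 0 \<longrightarrow> t \<ge> t3 \<longrightarrow>
          \<P>(X in iid_samples m D. L2_set (sample_mean m X) {..<d} \<ge> t)
            \<le> K * (1 + ln (real m)) powr 0 *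
                (real d powr (k / 2) / (real m powr (k - 1) * t powr k)))"
      by (intro exI[of _ t3]) (auto simp: t3_def)
  qed
qed
end
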